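(* A word $u\in\mathcal{W}_2$ of length $n$ is in $\mathcal{V}(\{0,1\})$ if and only if $n$ is a power of $2$ (including $1=2^0$).
   Context: $\mathcal{W}_2$ is the set of finite nonempty binary strings (words on the alphabet $\{0,1\}$), with multiplication $*$ given by concatenation; the size of a word is its length. The $\mathcal{V}$-set $\mathcal{V}(\{0,1\})\subset\mathcal{W}_2$ is built as follows: first put the one-letter words $0$ and $1$ into it; then repeatedly add a shortest word not already in the set that can be written in exactly one way as a concatenation $v*w$ of two (not necessarily distinct) words $v,w$ already in the set (representations are ordered pairs $(v,w)$). Ties among words of the same length may be broken arbitrarily without affecting the resulting set. Equivalently, a word $u$ of length at least $2$ is in $\mathcal{V}(\{0,1\})$ iff there is exactly one ordered pair $(v,w)$ of elements of $\mathcal{V}(\{0,1\})$ with $u=v*w$. *)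

theory Defs
  imports Main
begin

definition binary_words :: "nat list set" where
  "binary_words = {w. w \<noteq> [] \<and> set w \<subseteq> {0, 1}}"

definition uniquely_represented :: "'a list set \<Rightarrow> 'a list \<Rightarrow> bool" where
  "uniquely_represented S u \<longleftrightarrow> (\<exists>!p. p \<in> S \<times> S \<and> fst p @ snd p = u)"

definition V_candidates :: "'a list set \<Rightarrow> 'a list set" where
  "V_candidates S = {u. is_arg_min length (\<lambda>w. w \<notin> S \<and> uniquely_represented S w) u}"

text \<open>A tie-breaking rule picks one of the shortest admissible words; it may depend on the
  stage of the construction, so that every sequence of choices arises from some rule.\<close>

definition tie_breaking :: "(nat \<Rightarrow> 'a list set \<Rightarrow> 'a list) \<Rightarrow> bool" where
  "tie_breaking \<tau> \<longleftrightarrow> (\<forall>n C. C \<noteq> {} \<longrightarrow> \<tau> n C \<in> C)"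

primrec V_stage ::
  "(nat \<Rightarrow> 'a list set \<Rightarrow> 'a list) \<Rightarrow> 'a list set \<Rightarrow> nat \<Rightarrow> 'a list set" where
  "V_stage \<tau> X 0 = X"
| "V_stage \<tau> X (Suc n) =
    (let S = V_stage \<tau> X n; C = V_candidates S
     in if C = {} then S else insert (\<tau> n C) S)"

definition V_set :: "(nat \<Rightarrow> 'a list set \<Rightarrow> 'a list) \<Rightarrow> 'a list set \<Rightarrow> 'a list set" where
  "V_set \<tau> X = (\<Union>n. V_stage \<tau> X n)"

end

theory Submission
  imports Defs
begin

text \<open>
  Suppose that, up to some length, the set consists of all words whose length is a power of two.
  A word of the next length can then only be represented by pieces of lengths \<open>2 ^ a\<close> and \<open>2 ^ b\<close>.
  If \<open>a \<noteq> b\<close>, cutting the same word into pieces of lengths \<open>2 ^ b\<close> and \<open>2 ^ a\<close> instead gives a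
  second representation, so the word is rejected. If \<open>a = b\<close>, the length is \<open>2 ^ (a + 1)\<close>, and since
  \<open>2 ^ (a + 1)\<close> is a sum of two powers of two in no other way, the cut in the middle is the only one
  and the word is accepted.

  The construction adds one word at a time, so a length class is only partly filled at most stages.
  The invariant \<open>initial_segment\<close> therefore says that the stage contains every word of
  power-of-two length that is shorter than one of its elements. This suffices for the argument
  above, because the pieces of a word are strictly shorter than the word: by
  \<open>V_candidates_initial_segment\<close> the candidates are exactly the shortest missing words of
  power-of-two length, so every choice among them preserves the invariant. No such word is
  postponed forever: while \<open>u\<close> is missing, each stage adds a new word of length at most that of \<open>u\<close>,
  and there are only finitely many of those.
\<close>

definition power_words :: "nat list set" where
  "power_words = {w \<in> binary_words. \<exists>k. length w = 2 ^ k}"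

definition initial_segment :: "nat list set \<Rightarrow> bool" where
  "initial_segment S \<longleftrightarrow>
    {[0], [1]} \<subseteq> S \<and> S \<subseteq> power_words \<and>
    (\<forall>w\<in>S. \<forall>v\<in>power_words. length v < length w \<longrightarrow> v \<in> S)"

lemma binary_words_append:
  "v \<in> binary_words \<Longrightarrow> w \<in> binary_words \<Longrightarrow> v @ w \<in> binary_words"
  by (auto simp: binary_words_def)

lemma binary_words_take:
  "x \<in> binary_words \<Longrightarrow> 0 < i \<Longrightarrow> take i x \<in> binary_words"
  using set_take_subset[of i x] by (auto simp: binary_words_def)

lemma binary_words_drop:
  "x \<in> binary_words \<Longrightarrow> i < length x \<Longrightarrow> drop i x \<in> binary_words"
  using set_drop_subset[of i x] by (auto simp: binary_words_def)

text \<open>Two different powers of two cannot add up to a power of two: the sum lies strictly between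
  the larger one and its double.\<close>

lemma sum_powers_of_two_eq_power:
  fixes a b c :: nat
  assumes "2 ^ a + 2 ^ b = (2 ^ c :: nat)"
  shows "a = b"
proof -
  have no_less: "False" if eq: "2 ^ i + 2 ^ j = (2 ^ c :: nat)" and "i < j" for i j :: nat
  proof -
    have "(2::nat) ^ i < 2 ^ j" using \<open>i < j\<close> by simp
    then have "(2::nat) ^ c < 2 ^ Suc j" unfolding eq[symmetric] power_Suc by linarith
    moreover have "(2::nat) ^ j < 2 ^ c" unfolding eq[symmetric] by simp
    ultimately have "j < c" "c < Suc j"
      by (simp_all only: power_strict_increasing_iff one_less_numeral_iff semiring_norm)
    then show False by simp
  qed
  show ?thesis
    using no_less[OF assms] no_less[of b a] assms by (metis add.commute linorder_neqE_nat)
qed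

text \<open>Swapping the two lengths of a representation produces another one unless the lengths agree,
  so uniqueness forces a cut in the middle. The bound on the length of \<open>x\<close> ensures that the pieces
  of the swapped cut lie in \<open>S\<close>.\<close>

lemma uniquely_represented_imp_power_word:
  assumes sub: "S \<subseteq> power_words"
    and below: "\<And>v. v \<in> power_words \<Longrightarrow> length v < m \<Longrightarrow> v \<in> S"
    and unique: "uniquely_represented S x"
    and len: "length x \<le> m"
  shows "x \<in> power_words"
proof -
  obtain v w where vw: "v \<in> S" "w \<in> S" "v @ w = x"
    using ex1_implies_ex[OF unique[unfolded uniquely_represented_def]]
    by (elim exE conjE SigmaE) simp
  then obtain a b where a: "length v = 2 ^ a" and b: "length w = 2 ^ b"
    using sub unfolding power_words_def by blast
  have bin: "x \<in> binary_words"
    using vw sub binary_words_append unfolding power_words_def by blast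
  have lx: "length x = 2 ^ a + 2 ^ b" using arg_cong[OF vw(3), of length] a b by simp
  define v' where "v' = take (2 ^ b) x"
  define w' where "w' = drop (2 ^ b) x"
  have l: "length v' = 2 ^ b" "length w' = 2 ^ a"
    by (simp_all add: v'_def w'_def lx)
  have "v' \<in> power_words" "w' \<in> power_words"
    using l bin binary_words_take[of x "2 ^ b"] binary_words_drop[of x "2 ^ b"]
    by (auto simp: power_words_def v'_def w'_def lx)
  moreover have "length v' < m" "length w' < m"
    unfolding l by (rule less_le_trans[OF _ len[unfolded lx]], simp)+
  ultimately have "v' \<in> S" "w' \<in> S" using below by auto
  moreover have "v' @ w' = x" by (simp add: v'_def w'_def)
  ultimately have "(v', w') = (v, w)"
    using unique vw unfolding uniquely_represented_def
    by (metis SigmaI fst_conv snd_conv)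
  then have "length x = 2 ^ Suc b" using l a lx by auto
  then show ?thesis using bin unfolding power_words_def by blast
qed

lemma power_word_uniquely_represented:
  assumes sub: "S \<subseteq> power_words"
    and below: "\<And>v. v \<in> power_words \<Longrightarrow> length v < length u \<Longrightarrow> v \<in> S"
    and u: "u \<in> power_words" "length u \<noteq> 1"
  shows "uniquely_represented S u"
proof -
  obtain c where "length u = 2 ^ c" and bin: "u \<in> binary_words"
    using u(1) by (auto simp: power_words_def)
  then obtain k where k: "length u = 2 ^ Suc k"
    using u(2) by (cases c) auto
  have "take (2 ^ k) u \<in> power_words" "drop (2 ^ k) u \<in> power_words"
    using bin k binary_words_take[of u "2 ^ k"] binary_words_drop[of u "2 ^ k"]
    by (auto simp: power_words_def)
  then have half: "take (2 ^ k) u \<in> S" "drop (2 ^ k) u \<in> S"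
    using below k by auto
  have only_cut: "v = take (2 ^ k) u \<and> w = drop (2 ^ k) u"
    if vw: "v \<in> S" "w \<in> S" "v @ w = u" for v w
  proof -
    obtain a b where a: "length v = 2 ^ a" and b: "length w = 2 ^ b"
      using subsetD[OF sub vw(1)] subsetD[OF sub vw(2)] unfolding power_words_def by blast
    have eq: "2 ^ a + 2 ^ b = (2 ^ Suc k :: nat)" using vw(3) a b k by auto
    then have "a = b" by (rule sum_powers_of_two_eq_power)
    then have "length v = length w" using a b by simp
    then have "length v = 2 ^ k" using arg_cong[OF vw(3), of length] k by simp
    then show ?thesis using vw(3) by auto
  qed
  show ?thesis
    unfolding uniquely_represented_def
  proof (rule ex1I)
    show "(take (2 ^ k) u, drop (2 ^ k) u) \<in> S \<times> S \<and>
        fst (take (2 ^ k) u, drop (2 ^ k) u) @ snd (take (2 ^ k) u, drop (2 ^ k) u) = u"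
      using half by simp
  next
    fix p assume "p \<in> S \<times> S \<and> fst p @ snd p = u"
    then have "fst p \<in> S" "snd p \<in> S" "fst p @ snd p = u" by auto
    from only_cut[OF this] show "p = (take (2 ^ k) u, drop (2 ^ k) u)"
      by (simp only: prod_eq_iff fst_conv snd_conv)
  qed
qed

lemma exists_shortest:
  assumes "A \<noteq> {}"
  shows "\<exists>u. is_arg_min length (\<lambda>w. w \<in> A) u"
proof -
  obtain a where "a \<in> A" using assms by blast
  then show ?thesis
    using ex_has_least_nat[of "\<lambda>w. w \<in> A" a length] by (simp add: is_arg_min_linorder)
qed

text \<open>A shortest missing word of power-of-two length is longer than one letter, because both
  letters are in \<open>S\<close>, and its two halves are in \<open>S\<close>, hence it is admissible. Conversely,
  an admissible word that is not longer than it has power-of-two length, so it cannot be shorter and be missing as well.\<close>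

lemma V_candidates_initial_segment:
  assumes S: "initial_segment S" and missing: "power_words - S \<noteq> {}"
  shows "V_candidates S = {u. is_arg_min length (\<lambda>w. w \<in> power_words - S) u}"
proof -
  have sub: "S \<subseteq> power_words" and letters: "{[0], [1]} \<subseteq> S"
    using S by (auto simp: initial_segment_def)
  obtain u0 where u0: "is_arg_min length (\<lambda>w. w \<in> power_words - S) u0"
    using exists_shortest[OF missing] by blast
  have below: "v \<in> S" if "v \<in> power_words" "length v < length u0" for v
    using u0 that by (auto simp: is_arg_min_def)
  have admissible: "uniquely_represented S u" if u: "u \<in> power_words - S" "length u = length u0" for u
  proof (rule power_word_uniquely_represented[OF sub])
    show "length u \<noteq> 1"
    proof
      assume "length u = 1"
      then obtain x where x: "u = [x]" by (auto simp: length_Suc_conv)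
      then have "x \<in> {0, 1}" using u(1) by (simp add: power_words_def binary_words_def)
      then show False using u(1) letters x by blast
    qed
  qed (use u below in auto)
  have least: "x \<in> power_words \<and> length x = length u0"
    if "x \<notin> S" "uniquely_represented S x" "length x \<le> length u0" for x
    using uniquely_represented_imp_power_word[OF sub below that(2,3)] below that(1,3)
    by (metis le_neq_implies_less)
  have u0': "u0 \<in> power_words - S" "\<And>y. y \<in> power_words - S \<Longrightarrow> length u0 \<le> length y"
    using u0 by (auto simp: is_arg_min_linorder)
  have adm0: "u0 \<notin> S \<and> uniquely_represented S u0" using u0'(1) admissible by auto
  have "is_arg_min length (\<lambda>w. w \<notin> S \<and> uniquely_represented S w) x \<longleftrightarrow>
      x \<in> power_words - S \<and> length x = length u0" for x
  proof
    assume "is_arg_min length (\<lambda>w. w \<notin> S \<and> uniquely_represented S w) x"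
    then show "x \<in> power_words - S \<and> length x = length u0"
      using adm0 least[of x] by (auto simp: is_arg_min_linorder)
  next
    assume x: "x \<in> power_words - S \<and> length x = length u0"
    have "length x \<le> length y" if "y \<notin> S" "uniquely_represented S y" for y
      using least[OF that] x by linarith
    then show "is_arg_min length (\<lambda>w. w \<notin> S \<and> uniquely_represented S w) x"
      using x admissible[of x] by (auto simp: is_arg_min_linorder)
  qed
  moreover have "is_arg_min length (\<lambda>w. w \<in> power_words - S) x \<longleftrightarrow>
      x \<in> power_words - S \<and> length x = length u0" for x
    using u0' unfolding is_arg_min_linorder by (metis le_antisym)
  ultimately show ?thesis unfolding V_candidates_def by auto
qed

lemma initial_segment_insert:
  assumes "initial_segment S" "is_arg_min length (\<lambda>w. w \<in> power_words - S) u"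
  shows "initial_segment (insert u S)"
proof -
  have u: "u \<in> power_words" "\<And>v. v \<in> power_words \<Longrightarrow> length v < length u \<Longrightarrow> v \<in> S"
    using assms(2) by (auto simp: is_arg_min_def)
  then show ?thesis
    using assms(1) unfolding initial_segment_def by blast
qed

lemma exists_longer_power_word: "\<exists>w\<in>power_words. m < length w"
proof
  show "replicate (2 ^ m) 0 \<in> power_words" by (auto simp: power_words_def binary_words_def)
qed simp

lemma power_words_diff_finite_nonempty:
  assumes "finite S" shows "power_words - S \<noteq> {}"
proof -
  obtain w where "w \<in> power_words" "Max (length ` S) < length w"
    using exists_longer_power_word by blast
  then show ?thesis using assms by (metis Diff_iff Max_ge empty_iff finite_imageI imageI not_le)
qed

text \<open>The construction never stops, because every stage is finite and so some word of power-of-two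
  length is still missing. The cardinality shows that each step adds a new word.\<close>

lemma V_stage_invariant:
  assumes tb: "tie_breaking \<tau>"
  defines "S \<equiv> V_stage \<tau> {[0], [1]}"
  shows "initial_segment (S n) \<and> finite (S n) \<and> n < card (S n)"
proof (induction n)
  case 0
  have one: "\<exists>k. (1::nat) = 2 ^ k" by (rule exI[of _ 0]) simp
  have letters: "[0] \<in> power_words" "[1] \<in> power_words"
    using one by (simp_all add: power_words_def binary_words_def)
  have "[] \<notin> power_words" by (simp add: power_words_def binary_words_def)
  then have "v \<notin> power_words" if "length v < 1" for v
    using that by auto
  then have "initial_segment {[0], [1]}"
    using letters by (auto simp: initial_segment_def)
  then show ?case by (simp add: S_def)
next
  case (Suc n)
  then have seg: "initial_segment (S n)" and fin: "finite (S n)" and card: "n < card (S n)" by auto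
  let ?C = "V_candidates (S n)"
  have missing: "power_words - S n \<noteq> {}"
    using fin by (rule power_words_diff_finite_nonempty)
  note C = V_candidates_initial_segment[OF seg missing]
  have "?C \<noteq> {}"
    using exists_shortest[OF missing] unfolding C by blast
  then have in_C: "\<tau> n ?C \<in> ?C" and step: "S (Suc n) = insert (\<tau> n ?C) (S n)"
    using tb by (auto simp: tie_breaking_def S_def Let_def)
  have arg_min: "is_arg_min length (\<lambda>w. w \<in> power_words - S n) (\<tau> n ?C)"
    using in_C C by blast
  then have "\<tau> n ?C \<notin> S n" by (simp add: is_arg_min_def)
  then show ?case
    using initial_segment_insert[OF seg arg_min] fin card by (simp add: step)
qed

lemma V_set_eq_power_words:
  assumes tb: "tie_breaking \<tau>"
  shows "V_set \<tau> {[0], [1]} = power_words"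
proof
  have "V_stage \<tau> {[0], [1]} n \<subseteq> power_words" for n
    using V_stage_invariant[OF tb] unfolding initial_segment_def by blast
  then show "V_set \<tau> {[0], [1]} \<subseteq> power_words"
    unfolding V_set_def by (rule UN_least)
next
  show "power_words \<subseteq> V_set \<tau> {[0], [1]}"
  proof
    fix u assume u: "u \<in> power_words"
    let ?B = "{w. set w \<subseteq> {0, 1 :: nat} \<and> length w \<le> length u}"
    \<comment> \<open>The stage with index \<open>card ?B\<close> has too many elements to consist of words not longer
      than \<open>u\<close>, and an element longer than \<open>u\<close> forces \<open>u\<close> into the stage.\<close>
    let ?S = "V_stage \<tau> {[0], [1]} (card ?B)"
    have seg: "initial_segment ?S" and card: "card ?B < card ?S"
      using V_stage_invariant[OF tb, of "card ?B"] by auto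
    have "finite ?B" by (rule finite_lists_length_le) simp
    then have "\<not> ?S \<subseteq> ?B" using card card_mono[of ?B ?S] by linarith
    then obtain w where "w \<in> ?S" "w \<notin> ?B" by blast
    moreover have "w \<in> power_words"
      using seg \<open>w \<in> ?S\<close> unfolding initial_segment_def by blast
    ultimately have "length u < length w"
      by (simp add: power_words_def binary_words_def)
    then have "u \<in> ?S" using seg u \<open>w \<in> ?S\<close> unfolding initial_segment_def by blast
    then show "u \<in> V_set \<tau> {[0], [1]}" unfolding V_set_def by blast
  qed
qed

theorem theorem3p11:
  fixes \<tau> :: "nat \<Rightarrow> nat list set \<Rightarrow> nat list" and u :: "nat list" and n :: nat
  assumes "tie_breaking \<tau>"
    and "u \<in> binary_words"
    and "length u = n"
  shows "u \<in> V_set \<tau> {[0], [1]} \<longleftrightarrow> (\<exists>k::nat. n = 2 ^ k)"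
  unfolding V_set_eq_power_words[OF assms(1)] power_words_def using assms(2,3) by blast

end
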